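(* Let $\gamma\in\mathbb{C}$ with $0<|\gamma|<1$. For every integer $n\ge N_\gamma$ and every $j\in\{1,\ldots,n\}$, writing $s=s_{\gamma,n,j}$ and $$\mu=1+i\gamma\cos(s),\qquad \nu=i\gamma\sin(s),\qquad \xi=(i-\gamma\cos(s))\,\overline{\gamma\sin(s)},$$ one has $$\begin{aligned}\|v_{\gamma,n,j}\|_2^2={}&\frac{|\nu|^2-|\mu|^2}{2}\,\frac{\sin(n\operatorname{Re}(s))\cos((n+1)\operatorname{Re}(s))}{\sin(\operatorname{Re}(s))}+\frac{|\nu|^2+|\mu|^2}{2}\,\frac{\sinh(n\operatorname{Im}(s))\cosh((n+1)\operatorname{Im}(s))}{\sinh(\operatorname{Im}(s))}\\&+\operatorname{Re}(\xi)\,\frac{\sin(n\operatorname{Re}(s))\sin((n+1)\operatorname{Re}(s))}{\sin(\operatorname{Re}(s))}-\operatorname{Im}(\xi)\,\frac{\sinh(n\operatorname{Im}(s))\sinh((n+1)\operatorname{Im}(s))}{\sinh(\operatorname{Im}(s))},\end{aligned}$$ where, if $\operatorname{Im}(s)=0$, the quotient $\sinh(n\operatorname{Im}(s))/\sinh(\operatorname{Im}(s))$ is understood as its limit value $n$.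
   Context: $\Delta_\gamma=\ln\frac{1}{|\gamma|}$. For $|\operatorname{Im}(z)|<\Delta_\gamma$, $$\vartheta_\gamma(z)=-\frac{i}{2}\ln\left(\frac{1+i\gamma e^{iz}}{1+i\gamma e^{-iz}}\right),$$ where $\ln$ is the principal branch of the logarithm on $\mathbb{C}\setminus(-\infty,0]$ (the argument of the logarithm lies in this set for all such $z$). Definition of $s_{\gamma,n,j}$: put $d_{n,j}=\frac{j\pi}{n+1}$, $p_{\gamma,n,j}=d_{n,j}+\frac{\vartheta_\gamma(d_{n,j})}{n+1}$, $M_\gamma=\frac{64\sqrt{|\gamma|}}{(1-|\gamma|)^3}$, $N_\gamma=\frac{16}{(1-|\gamma|)^2}$, and $\mathcal{B}_{\gamma,n,j}=\{z\in\mathbb{C}\colon |z-p_{\gamma,n,j}|<M_\gamma/(n+1)^2\}$. For every integer $n\ge N_\gamma$ and $j\in\{1,\ldots,n\}$, $s_{\gamma,n,j}$ is the unique point of $\mathcal{B}_{\gamma,n,j}$ with $s_{\gamma,n,j}=\frac{j\pi}{n+1}+\frac{\vartheta_\gamma(s_{\gamma,n,j})}{n+1}$; it satisfies $0<\operatorname{Re}(s_{\gamma,n,j})<\pi$. The vector $v_{\gamma,n,j}=[v_{\gamma,n,j,k}]_{k=1}^n\in\mathbb{C}^n$ has components $$v_{\gamma,n,j,k}=(-i)^k\bigl(\sin(k s_{\gamma,n,j})+i\gamma\sin((k-1)s_{\gamma,n,j})\bigr),\qquad 1\le k\le n$$ (it is an eigenvector, with eigenvalue $2i\cos(s_{\gamma,n,j})$,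 of the $n\times n$ matrix $A_{\gamma,n}$ having $(1,1)$ entry $\gamma$, entries $1$ on the first subdiagonal, $-1$ on the first superdiagonal, and $0$ elsewhere). $\|\cdot\|_2$ is the Euclidean norm on $\mathbb{C}^n$. *)

theory Defs
  imports "HOL-Analysis.Analysis"
begin

text \<open>
  On complex numbers, \<^const>\<open>ln\<close> is the principal branch. The intended domain of \<open>theta \<gamma>\<close>
  is the open strip \<open>\<bar>Im z\<bar> < ln (1 / \<bar>\<gamma>\<bar>)\<close>; its values elsewhere carry no meaning.
\<close>

definition theta :: "complex \<Rightarrow> complex \<Rightarrow> complex" where
  "theta \<gamma> z =
     - (\<i> / 2) * ln ((1 + \<i> * \<gamma> * exp (\<i> * z)) / (1 + \<i> * \<gamma> * exp (- \<i> * z)))"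

definition d_point :: "nat \<Rightarrow> nat \<Rightarrow> real" where
  "d_point n j = real j * pi / (real n + 1)"

definition p_point :: "complex \<Rightarrow> nat \<Rightarrow> nat \<Rightarrow> complex" where
  "p_point \<gamma> n j =
     of_real (d_point n j) + theta \<gamma> (of_real (d_point n j)) / (of_nat n + 1)"

definition M_const :: "complex \<Rightarrow> real" where
  "M_const \<gamma> = 64 * sqrt (cmod \<gamma>) / (1 - cmod \<gamma>) ^ 3"

definition N_const :: "complex \<Rightarrow> real" where
  "N_const \<gamma> = 16 / (1 - cmod \<gamma>) ^ 2"

definition B_disk :: "complex \<Rightarrow> nat \<Rightarrow> nat \<Rightarrow> complex set" where
  "B_disk \<gamma> n j = {z. cmod (z - p_point \<gamma> n j) < M_const \<gamma> / (real n + 1) ^ 2}"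

text \<open>
  For \<open>0 < \<bar>\<gamma>\<bar> < 1\<close>, \<open>n \<ge> N_const \<gamma>\<close> and \<open>1 \<le> j \<le> n\<close>, the disk \<open>B_disk \<gamma> n j\<close> is contained in
  the strip on which \<open>theta \<gamma>\<close> is meaningful, and exactly one of its points solves the equation
  below. For other parameters \<open>s_point\<close> is unspecified.
\<close>

definition s_point :: "complex \<Rightarrow> nat \<Rightarrow> nat \<Rightarrow> complex" where
  "s_point \<gamma> n j =
     (THE z. z \<in> B_disk \<gamma> n j \<and>
             z = of_real (real j * pi / (real n + 1)) + theta \<gamma> z / (of_nat n + 1))"

text \<open>
  A vector in \<open>\<complex>\<^sup>n\<close> is represented by its components with indices in \<open>{1..n}\<close>; its Euclidean norm
  is \<^const>\<open>L2_set\<close> of the component moduli over that index set.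
\<close>

definition v_comp :: "complex \<Rightarrow> nat \<Rightarrow> nat \<Rightarrow> nat \<Rightarrow> complex" where
  "v_comp \<gamma> n j k =
     (- \<i>) ^ k * (sin (of_nat k * s_point \<gamma> n j)
                  + \<i> * \<gamma> * sin ((of_nat k - 1) * s_point \<gamma> n j))"

definition v_norm :: "complex \<Rightarrow> nat \<Rightarrow> nat \<Rightarrow> real" where
  "v_norm \<gamma> n j = L2_set (\<lambda>k. cmod (v_comp \<gamma> n j k)) {1..n}"

text \<open>\<open>sinh (n y) / sinh y\<close>, extended by its limit at \<open>y = 0\<close> (plain division would give \<open>0\<close>).\<close>

definition sinh_quot :: "nat \<Rightarrow> real \<Rightarrow> real" where
  "sinh_quot n y = (if y = 0 then real n else sinh (real n * y) / sinh y)"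

end

theory Submission
  imports Defs
begin

text \<open>
  Put \<open>s = s_point \<gamma> n j\<close>. The addition theorem for \<open>sin ((k - 1) s)\<close> turns the \<open>k\<close>-th component
  of the vector, up to the unimodular factor \<open>(- \<i>) ^ k\<close>, into \<open>\<mu> sin (k s) - \<nu> cos (k s)\<close>.
  Its squared modulus is a linear combination of \<open>cos\<close> and \<open>sin\<close> of \<open>2 k Re s\<close> and of \<open>cosh\<close> and
  \<open>sinh\<close> of \<open>2 k Im s\<close>, with coefficients independent of \<open>k\<close>
  (\<open>cmod_sin_cos_combination_squared\<close>). Each of the four sums over \<open>k\<close> telescopes after
  multiplication by \<open>sin (Re s)\<close> or \<open>sinh (Im s)\<close>, which gives the four quotients of the formula;
  for \<open>Im s = 0\<close> the two hyperbolic sums are \<open>n\<close> and \<open>0\<close>.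
  The cross terms have coefficient \<open>\<mu> * cnj \<nu> = - \<xi>\<close>.

  Telescoping needs \<open>sin (Re s) \<noteq> 0\<close>, and this is where the hypotheses on \<open>\<gamma>\<close>, \<open>n\<close> and \<open>j\<close> enter:
  they give \<open>0 < Re s < \<pi>\<close> (\<open>Re_s_point_bounds\<close>). Since \<open>s\<close> is a definite description, its
  defining equation \<open>s = d + \<vartheta>(s) / (n + 1)\<close> must first be shown to have exactly one solution in the
  disk. Let \<open>q = sqrt \<bar>\<gamma>\<bar>\<close>. On the strip \<open>\<bar>Im z\<bar> \<le> - ln q\<close>, half as wide as the natural strip of
  \<open>\<vartheta>\<close>, both \<open>\<gamma> exp (\<i> z)\<close> and \<open>\<gamma> exp (- \<i> z)\<close> have modulus at most \<open>q\<close>, hence \<open>\<vartheta>\<close> is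
  Lipschitz there with constant \<open>q / (1 - q)\<close> (\<open>theta_lipschitz\<close>). For \<open>n \<ge> N_const \<gamma>\<close> the right-hand
  side of the equation therefore has Lipschitz constant at most \<open>1 / 8\<close>, and Banach's theorem applies
  on the disk. Moreover \<open>\<vartheta>\<close> vanishes at \<open>0\<close> and at \<open>\<pi>\<close>, so the Lipschitz bound gives
  \<open>\<bar>\<vartheta>(s)\<bar> / (n + 1) \<le> \<bar>s\<bar> / 8\<close> and likewise with \<open>\<bar>s - \<pi>\<bar>\<close>. The correction to \<open>d\<close> is
  thus too small to push the solution out of the strip \<open>0 < Re z < \<pi>\<close>
  (\<open>Re_fixed_point_pos\<close>, used at both ends of the interval).
\<close>

section \<open>Lipschitz continuity and zeros of the phase function\<close>

lemma Re_one_plus_pos: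
  fixes w :: complex
  assumes "cmod w < 1"
  shows "0 < Re (1 + w)"
  using assms abs_Re_le_cmod[of w] by auto

lemma norm_exp_i_times_le:
  assumes "\<bar>Im z\<bar> \<le> a"
  shows "cmod (exp (\<i> * z)) \<le> exp a" "cmod (exp (- \<i> * z)) \<le> exp a"
  using assms by auto

text \<open>
  The principal logarithm is differentiable at the quotient because numerator and denominator both
  lie in the open right half-plane, and a quotient of two such numbers is never a nonpositive real.
\<close>

lemma theta_has_field_derivative:
  assumes "cmod \<gamma> * exp \<bar>Im z\<bar> < 1"
  shows "(theta \<gamma> has_field_derivative
           \<i> / 2 * (\<gamma> * exp (\<i> * z) / (1 + \<i> * \<gamma> * exp (\<i> * z))
                  + \<gamma> * exp (- \<i> * z) / (1 + \<i> * \<gamma> * exp (- \<i> * z)))) (at z)"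
proof -
  define E F where "E = exp (\<i> * z)" and "F = exp (- \<i> * z)"
  define A B where "A = 1 + \<i> * \<gamma> * E" and "B = 1 + \<i> * \<gamma> * F"
  have le: "cmod E \<le> exp \<bar>Im z\<bar>" "cmod F \<le> exp \<bar>Im z\<bar>"
    unfolding E_def F_def by (rule norm_exp_i_times_le; simp)+
  have small: "cmod (\<i> * \<gamma> * E) < 1" "cmod (\<i> * \<gamma> * F) < 1"
    using mult_left_mono[OF le(1), of "cmod \<gamma>"] mult_left_mono[OF le(2), of "cmod \<gamma>"] assms
    by (auto simp: norm_mult)
  have pos: "0 < Re A" "0 < Re B"
    unfolding A_def B_def using small by (simp_all only: Re_one_plus_pos)
  have nz: "A \<noteq> 0" "B \<noteq> 0"
    using pos by auto
  have slit: "A / B \<notin> \<real>\<^sub>\<le>\<^sub>0"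
  proof
    assume "A / B \<in> \<real>\<^sub>\<le>\<^sub>0"
    then obtain t where t: "A / B = of_real t" "t \<le> 0"
      by (auto elim: nonpos_Reals_cases)
    then have "A = of_real t * B"
      using nz by (simp add: field_simps)
    then have "Re A = t * Re B"
      by simp
    with pos t(2) show False
      by (metis mult_nonneg_nonpos2 less_le_not_le mult.commute)
  qed
  have dE: "((\<lambda>z. exp (\<i> * z)) has_field_derivative \<i> * E) (at z)"
    and dF: "((\<lambda>z. exp (- \<i> * z)) has_field_derivative - \<i> * F) (at z)"
    unfolding E_def F_def by (auto intro!: derivative_eq_intros)
  have dA: "((\<lambda>z. 1 + \<i> * \<gamma> * exp (\<i> * z)) has_field_derivative \<i> * \<gamma> * (\<i> * E)) (at z)"
    using DERIV_add[OF DERIV_const DERIV_cmult[OF dE]] by (simp only: add_0_left)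
  have dB: "((\<lambda>z. 1 + \<i> * \<gamma> * exp (- \<i> * z)) has_field_derivative \<i> * \<gamma> * (- \<i> * F)) (at z)"
    using DERIV_add[OF DERIV_const DERIV_cmult[OF dF]] by (simp only: add_0_left)
  have "((\<lambda>z. (1 + \<i> * \<gamma> * exp (\<i> * z)) / (1 + \<i> * \<gamma> * exp (- \<i> * z))) has_field_derivative
          (\<i> * \<gamma> * (\<i> * E) * B - A * (\<i> * \<gamma> * (- \<i> * F))) / (B * B)) (at z)"
    using DERIV_divide[OF dA dB] nz(2) unfolding A_def B_def E_def F_def by simp
  from DERIV_cmult[OF DERIV_chain2[OF
        has_field_derivative_Ln[OF slit[unfolded A_def B_def E_def F_def]] this], of "- (\<i> / 2)"]
  have "(theta \<gamma> has_field_derivative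
          - (\<i> / 2) * (inverse (A / B)
             * ((\<i> * \<gamma> * (\<i> * E) * B - A * (\<i> * \<gamma> * (- \<i> * F))) / (B * B)))) (at z)"
    unfolding theta_def[abs_def] A_def B_def E_def F_def .
  also have "- (\<i> / 2) * (inverse (A / B)
        * ((\<i> * \<gamma> * (\<i> * E) * B - A * (\<i> * \<gamma> * (- \<i> * F))) / (B * B)))
      = \<i> / 2 * (\<gamma> * E / A + \<gamma> * F / B)"
    using nz by (simp add: divide_simps) (simp add: algebra_simps)
  finally show ?thesis
    unfolding A_def B_def E_def F_def .
qed

text \<open>
  Both summands of the derivative have the form \<open>w / (1 + \<i> w)\<close> with \<open>\<bar>w\<bar> \<le> q\<close>, hence modulus at
  most \<open>q / (1 - q)\<close>; the strip is convex, so the bound on the derivative is a Lipschitz constant.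
\<close>

lemma theta_lipschitz:
  assumes q: "cmod \<gamma> * exp a \<le> q" "q < 1"
    and z: "\<bar>Im z\<bar> \<le> a" and w: "\<bar>Im w\<bar> \<le> a"
  shows "cmod (theta \<gamma> z - theta \<gamma> w) \<le> q / (1 - q) * cmod (z - w)"
proof (rule field_differentiable_bound[where S = "{z. \<bar>Im z\<bar> \<le> a}"])
  have "{z. \<bar>Im z\<bar> \<le> a} = {z. Im z \<le> a} \<inter> {z. Im z \<ge> -a}"
    by auto
  then show "convex {z. \<bar>Im z\<bar> \<le> a}"
    by (simp add: convex_Int convex_halfspace_Im_le convex_halfspace_Im_ge)
next
  fix u assume u: "u \<in> {z. \<bar>Im z\<bar> \<le> a}"
  have "cmod \<gamma> * exp \<bar>Im u\<bar> \<le> cmod \<gamma> * exp a"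
    using u by (intro mult_left_mono) auto
  then show "(theta \<gamma> has_field_derivative
           \<i> / 2 * (\<gamma> * exp (\<i> * u) / (1 + \<i> * \<gamma> * exp (\<i> * u))
                  + \<gamma> * exp (- \<i> * u) / (1 + \<i> * \<gamma> * exp (- \<i> * u))))
          (at u within {z. \<bar>Im z\<bar> \<le> a})"
    using q by (intro has_field_derivative_at_within[OF theta_has_field_derivative]) linarith
  have quot: "cmod (\<gamma> * E / (1 + \<i> * \<gamma> * E)) \<le> q / (1 - q)" if "cmod E \<le> exp a" for E
  proof -
    have "cmod (\<gamma> * E) \<le> q"
      using mult_left_mono[OF that, of "cmod \<gamma>"] q by (simp add: norm_mult)
    moreover from this have "1 - q \<le> cmod (1 + \<i> * \<gamma> * E)"
      using norm_diff_ineq[of 1 "\<i> * \<gamma> * E"] by (simp add: norm_mult)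
    ultimately show ?thesis
      unfolding norm_divide using q(2) by (intro frac_le) (auto intro: order_trans[OF norm_ge_zero])
  qed
  define X Y where "X = \<gamma> * exp (\<i> * u) / (1 + \<i> * \<gamma> * exp (\<i> * u))"
    and "Y = \<gamma> * exp (- \<i> * u) / (1 + \<i> * \<gamma> * exp (- \<i> * u))"
  have "cmod X \<le> q / (1 - q)" "cmod Y \<le> q / (1 - q)"
    unfolding X_def Y_def using u by (auto intro!: quot)
  then have "cmod (X + Y) \<le> 2 * (q / (1 - q))"
    using norm_triangle_ineq[of X Y] by linarith
  moreover have "cmod (\<i> / 2 * (X + Y)) = cmod (X + Y) / 2"
    by (simp add: norm_mult norm_divide)
  ultimately have "cmod (\<i> / 2 * (X + Y)) \<le> q / (1 - q)"
    by linarith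
  then show "cmod (\<i> / 2 * (\<gamma> * exp (\<i> * u) / (1 + \<i> * \<gamma> * exp (\<i> * u))
                  + \<gamma> * exp (- \<i> * u) / (1 + \<i> * \<gamma> * exp (- \<i> * u)))) \<le> q / (1 - q)"
    unfolding X_def Y_def .
qed (use z w in auto)

lemma theta_0:
  assumes "cmod \<gamma> < 1"
  shows "theta \<gamma> 0 = 0"
proof -
  have "0 < Re (1 + \<i> * \<gamma>)"
    using assms by (intro Re_one_plus_pos) (simp add: norm_mult)
  then have "1 + \<i> * \<gamma> \<noteq> 0"
    by (metis less_irrefl zero_complex.simps(1))
  then show ?thesis
    by (simp add: theta_def)
qed

lemma theta_pi:
  assumes "cmod \<gamma> < 1"
  shows "theta \<gamma> (of_real pi) = 0"
proof -
  have "0 < Re (1 + \<i> * \<gamma> * (-1))"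
    using assms by (intro Re_one_plus_pos) (simp add: norm_mult)
  then have "1 + \<i> * \<gamma> * (-1) \<noteq> 0"
    by (metis less_irrefl zero_complex.simps(1))
  moreover have "exp (- \<i> * of_real pi) = -1"
    by (simp add: exp_minus)
  ultimately show ?thesis
    unfolding theta_def exp_pi_i by simp
qed

section \<open>The defining equation of the spectral points\<close>

text \<open>
  A perturbation \<open>t\<close> of \<open>x > 0\<close> that is less than half as large as the result \<open>s = x + t\<close> satisfies
  \<open>\<bar>s\<bar> < 2 x\<close> and hence \<open>\<bar>t\<bar> < x\<close>. With \<open>s\<close> and with \<open>\<pi> - s\<close> this keeps the solution away from
  both ends of the interval.
\<close>

lemma Re_fixed_point_pos:
  fixes s t :: complex and x L :: real
  assumes s: "s = of_real x + t" and x: "0 < x"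
    and t: "cmod t \<le> L * cmod s" and L: "L < 1 / 2" "0 \<le> L"
  shows "0 < Re s"
proof -
  have "cmod s \<le> x + L * cmod s"
    using norm_triangle_ineq[of "of_real x" t] t s x by simp
  moreover have "L * cmod s \<le> 1 / 2 * cmod s"
    using L by (intro mult_right_mono) auto
  ultimately have "cmod s \<le> 2 * x"
    by linarith
  moreover have "s \<noteq> 0"
    using s t x by auto
  then have "L * cmod s < 1 / 2 * cmod s"
    using L by simp
  ultimately have "cmod t < x"
    using t by linarith
  then show ?thesis
    using s abs_Re_le_cmod[of t] by simp
qed

text \<open>
  A quantitative form of Banach's theorem: a contraction that moves the centre by less than
  \<open>(1 - c) r\<close> maps the closed ball into the open one, so the fixed point found in the complete
  closed ball lies in the open ball.
\<close>

lemma banach_fix_ball: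
  fixes f :: "'a :: {real_normed_vector, complete_space} \<Rightarrow> 'a"
  assumes r: "0 \<le> r" and c: "0 \<le> c" "c < 1"
    and lip: "\<And>z w. z \<in> cball p r \<Longrightarrow> w \<in> cball p r \<Longrightarrow> dist (f z) (f w) \<le> c * dist z w"
    and centre: "dist p (f p) < (1 - c) * r"
  shows "\<exists>!z. z \<in> ball p r \<and> f z = z"
proof -
  have maps: "f z \<in> ball p r" if "z \<in> cball p r" for z
  proof -
    have "dist p (f z) \<le> dist p (f p) + dist (f p) (f z)"
      by (rule dist_triangle)
    also have "dist (f p) (f z) \<le> c * dist p z"
      using that r by (intro lip) auto
    also have "c * dist p z \<le> c * r"
      using that c by (intro mult_left_mono) auto
    finally show ?thesis
      using centre by (simp add: algebra_simps)
  qed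
  have "\<exists>!z\<in>cball p r. f z = z"
  proof (rule Banach_fix)
    show "complete (cball p r)" by (simp add: complete_eq_closed)
    show "cball p r \<noteq> {}" using r by simp
    show "f ` cball p r \<subseteq> cball p r" using maps ball_subset_cball by blast
  qed (use c lip in auto)
  then show ?thesis
    using maps ball_subset_cball by (metis subsetD)
qed

text \<open>
  The estimates are written in terms of \<open>q = sqrt \<bar>\<gamma>\<bar>\<close> and \<open>u = 1 - \<bar>\<gamma>\<bar>\<close>. Then \<open>n \<ge> N_const \<gamma>\<close>
  yields \<open>1 / (n + 1) \<le> u\<^sup>2 / 16\<close>, and the radius \<open>r\<close> of the disk and the Lipschitz constant
  \<open>L\<close> of the right-hand side obey \<open>r \<le> q u / 4\<close> and \<open>L \<le> q u / 8\<close>. Together with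
  \<open>q u \<le> 2 (1 - q) \<le> 2 (- ln q)\<close> these place the disk inside the strip on which the Lipschitz bound holds.
\<close>

lemma s_equation_unique_solution:
  assumes g: "0 < cmod \<gamma>" "cmod \<gamma> < 1"
    and n: "real n \<ge> N_const \<gamma>"
    and j: "j \<in> {1..n}"
  defines "f \<equiv> \<lambda>z. of_real (real j * pi / (real n + 1)) + theta \<gamma> z / (of_nat n + 1)"
  shows "\<exists>!z. z \<in> B_disk \<gamma> n j \<and> z = f z"
    and "\<And>z. z \<in> B_disk \<gamma> n j \<Longrightarrow> z = f z \<Longrightarrow> 0 < Re z \<and> Re z < pi"
proof -
  define q where "q = sqrt (cmod \<gamma>)"
  define m where "m = real n + 1"
  define d where "d = d_point n j"
  define p where "p = p_point \<gamma> n j"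
  define r where "r = M_const \<gamma> / m\<^sup>2"
  define C where "C = q / (1 - q)"
  define L where "L = C / m"
  define a where "a = - ln q"
  define u where "u = 1 - q\<^sup>2"
  have q: "0 < q" "q < 1" and q2: "cmod \<gamma> = q\<^sup>2"
    using g by (auto simp: q_def)
  have om: "of_nat n + 1 = (of_real m :: complex)"
    by (simp add: m_def)
  have f_eq: "f z = of_real d + theta \<gamma> z / of_real m" for z
    unfolding f_def d_def d_point_def om by simp
  have p_eq: "p = f (of_real d)"
    unfolding p_def p_point_def f_eq om d_def ..
  have ball_eq: "B_disk \<gamma> n j = ball p r"
    by (auto simp: B_disk_def p_def r_def m_def dist_norm norm_minus_commute)
  have m0: "0 < m" by (simp add: m_def)
  have g1: "0 < u" "u < 1"
    using q g(2) q2 by (auto simp: u_def)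
  have u_fact: "u = (1 - q) * (1 + q)"
    by (simp add: u_def power2_eq_square algebra_simps)
  have mN: "16 / u\<^sup>2 \<le> m"
    using n unfolding N_const_def m_def q2 u_def by simp
  have C0: "0 \<le> C" using q by (simp add: C_def)
  have L0: "0 \<le> L" using C0 m0 by (simp add: L_def)
  have C_le: "C \<le> 2 * q / u"
  proof -
    have "C = q * (1 + q) / u"
      unfolding C_def u_fact using q by simp
    also have "\<dots> \<le> 2 * q / u"
      using q g1 by (intro divide_right_mono) auto
    finally show ?thesis .
  qed
  have inv_m: "1 / m \<le> u\<^sup>2 / 16"
    using le_imp_inverse_le[OF mN] g1 by (simp add: divide_simps)
  have L_le: "L \<le> q * u / 8"
  proof -
    have "C * (1 / m) \<le> (2 * q / u) * (u\<^sup>2 / 16)"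
      using C_le inv_m C0 m0 q g1 by (intro mult_mono) auto
    also have "\<dots> = q * u / 8"
      using g1 by (simp add: field_simps power2_eq_square)
    finally show ?thesis by (simp add: L_def)
  qed
  have q1q: "q * u \<le> 2 * (1 - q)"
  proof -
    have "q * u = (q * (1 + q)) * (1 - q)"
      by (simp add: u_fact)
    also have "\<dots> \<le> 2 * (1 - q)"
      using q mult_mono[of q 1 "1 + q" 2] by (intro mult_right_mono) auto
    finally show ?thesis .
  qed
  have "q * u \<le> 1"
    using q g1 mult_mono[of q 1 "u" 1] by auto
  then have L8: "L \<le> 1 / 8"
    using L_le by linarith
  have r_eq: "r = 64 * q / u ^ 3 * (1 / m * (1 / m))"
    unfolding r_def M_const_def q_def[symmetric] unfolding u_def q2
    by (simp add: power2_eq_square)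
  have r0: "0 < r"
    unfolding r_eq using q g1 m0 by simp
  have r_le: "r \<le> q * u / 4"
  proof -
    have "r \<le> 64 * q / u ^ 3 * (u\<^sup>2 / 16 * (u\<^sup>2 / 16))"
      unfolding r_eq using inv_m m0 q g1 by (intro mult_left_mono mult_mono) auto
    also have "\<dots> = q * u / 4"
      using g1 by (simp add: field_simps power2_eq_square power3_eq_cube)
    finally show ?thesis .
  qed
  have d_eq: "d = real j / m * pi"
    by (simp add: d_def d_point_def m_def)
  have "0 < real j / m" "real j / m < 1"
    using j by (auto simp: m_def)
  then have d0: "0 < d" "d < pi"
    using mult_strict_right_mono[OF _ pi_gt_zero] unfolding d_eq by fastforce+
  have a: "cmod \<gamma> * exp a \<le> q" "1 - q \<le> a"
    using q ln_le_minus_one[of q] by (auto simp: a_def q2 exp_minus power2_eq_square)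
  have a0: "0 \<le> a" using a q by simp
  note lip = theta_lipschitz[OF a(1) q(2), folded C_def]
  have th0: "cmod (theta \<gamma> z) \<le> C * cmod z" if "\<bar>Im z\<bar> \<le> a" for z
    using lip[OF that, of 0] a0 theta_0[OF g(2)] by simp
  have thpi: "cmod (theta \<gamma> z) \<le> C * cmod (z - of_real pi)" if "\<bar>Im z\<bar> \<le> a" for z
    using lip[OF that, of "of_real pi"] a0 theta_pi[OF g(2)] by simp
  \<comment> \<open>Using the nearer of the two zeros of \<open>\<vartheta>\<close> halves the bound on \<open>\<bar>p - d\<bar>\<close>, and this makes the
     height estimate \<open>r + 2 L\<close> small enough for the disk to fit into the strip.\<close>
  have thd: "cmod (theta \<gamma> (of_real d)) \<le> C * (pi / 2)"
  proof (cases "d \<le> pi / 2")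
    case True
    have "cmod (theta \<gamma> (of_real d)) \<le> C * d"
      using th0[of "of_real d"] a0 d0 by simp
    also have "\<dots> \<le> C * (pi / 2)"
      using True C0 by (intro mult_left_mono)
    finally show ?thesis .
  next
    case False
    have "cmod (of_real d - of_real pi) = pi - d"
      using d0 by (simp flip: of_real_diff)
    then have "cmod (theta \<gamma> (of_real d)) \<le> C * (pi - d)"
      using thpi[of "of_real d"] a0 by simp
    also have "\<dots> \<le> C * (pi / 2)"
      using False C0 by (intro mult_left_mono) auto
    finally show ?thesis .
  qed
  have pd: "cmod (p - of_real d) \<le> 2 * L"
  proof -
    have "cmod (p - of_real d) \<le> L * (pi / 2)"
      using thd m0 by (simp add: L_def p_eq f_eq norm_divide field_simps)
    also have "\<dots> \<le> L * 2"
      using L0 pi_less_4 by (intro mult_left_mono) auto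
    finally show ?thesis by simp
  qed
  \<comment> \<open>The disk is centred close to the real point \<open>d\<close>, so its height is at most \<open>r + 2 L\<close>.\<close>
  have slab: "\<bar>Im z\<bar> \<le> a" if "z \<in> cball p r" for z
  proof -
    have "\<bar>Im z\<bar> \<le> cmod (z - of_real d)"
      using abs_Im_le_cmod[of "z - of_real d"] by simp
    also have "\<dots> \<le> cmod (z - p) + cmod (p - of_real d)"
      using norm_triangle_ineq[of "z - p" "p - of_real d"] by simp
    also have "\<dots> \<le> r + 2 * L"
      using that pd by (simp add: dist_norm norm_minus_commute)
    also have "\<dots> \<le> q * u / 4 + 2 * (q * u / 8)"
      using r_le L_le by (intro add_mono mult_left_mono) auto
    also have "\<dots> \<le> 1 - q"
      using q1q by simp
    also have "\<dots> \<le> a"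
      by (rule a(2))
    finally show ?thesis .
  qed
  have lipf: "dist (f z) (f w) \<le> L * dist z w" if "\<bar>Im z\<bar> \<le> a" "\<bar>Im w\<bar> \<le> a" for z w
    using lip[OF that] m0
    by (simp add: L_def f_eq dist_norm norm_divide divide_right_mono flip: diff_divide_distrib)
  \<comment> \<open>The centre is itself the image of \<open>d\<close>, so its displacement is at most \<open>L \<bar>d - p\<bar> \<le> 2 L\<^sup>2\<close>,
     which is of the same order \<open>1 / (n + 1)\<^sup>2\<close> as the radius but smaller by the factor \<open>q u / 8\<close>.\<close>
  have centre: "dist p (f p) < (1 - L) * r"
  proof -
    have "dist p (f p) \<le> L * dist (of_real d) p"
      unfolding p_eq using lipf[of "of_real d" p] slab[of p] a0 r0 by (simp add: p_eq)
    also have "\<dots> \<le> L * (2 * L)"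
      using pd L0 by (intro mult_left_mono) (auto simp: dist_norm norm_minus_commute)
    also have "\<dots> = 2 * C\<^sup>2 * (1 / m * (1 / m))"
      by (simp add: L_def power2_eq_square)
    also have "\<dots> \<le> 2 * (2 * q / u)\<^sup>2 * (1 / m * (1 / m))"
      using C_le C0 by (intro mult_right_mono mult_left_mono power_mono) auto
    also have "\<dots> = r * (q * u / 8)"
      unfolding r_eq using g1 by (simp add: field_simps power2_eq_square power3_eq_cube)
    also have "\<dots> < (1 - L) * r"
    proof -
      have "q * u / 8 < 1 - L"
        using L8 \<open>q * u \<le> 1\<close> by linarith
      then show ?thesis using r0 by simp
    qed
    finally show ?thesis .
  qed
  have "\<exists>!z. z \<in> ball p r \<and> f z = z"
    using r0 L0 L8 centre slab by (intro banach_fix_ball[of r "L"] lipf) auto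
  then show "\<exists>!z. z \<in> B_disk \<gamma> n j \<and> z = f z"
    unfolding ball_eq by metis
  fix z assume z: "z \<in> B_disk \<gamma> n j" "z = f z"
  have Im_z: "\<bar>Im z\<bar> \<le> a"
    using z slab unfolding ball_eq by auto
  define t where "t = theta \<gamma> z / of_real m"
  have z_eq: "z = of_real d + t"
    using z(2) unfolding f_eq t_def .
  have t: "cmod t \<le> L * cmod z" "cmod (- t) \<le> L * cmod (of_real pi - z)"
    using th0[OF Im_z] thpi[OF Im_z] m0
    by (auto simp: L_def t_def norm_divide divide_right_mono norm_minus_commute)
  have L: "L < 1 / 2"
    using L8 by simp
  have "0 < Re z"
    by (rule Re_fixed_point_pos[OF z_eq d0(1) t(1) L L0])
  moreover have "of_real pi - z = of_real (pi - d) + - t"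
    by (simp add: z_eq)
  then have "0 < Re (of_real pi - z)"
    by (rule Re_fixed_point_pos[OF _ _ t(2) L L0]) (use d0 in simp)
  ultimately show "0 < Re z \<and> Re z < pi"
    by simp
qed

lemma Re_s_point_bounds:
  assumes "0 < cmod \<gamma>" "cmod \<gamma> < 1" "real n \<ge> N_const \<gamma>" "j \<in> {1..n}"
  shows "0 < Re (s_point \<gamma> n j)" "Re (s_point \<gamma> n j) < pi"
  using s_equation_unique_solution(2)[OF assms, of "s_point \<gamma> n j"]
    theI'[OF s_equation_unique_solution(1)[OF assms]]
  unfolding s_point_def by auto

section \<open>Sums of trigonometric and hyperbolic functions of even multiples\<close>

text \<open>
  Telescoping, where the difference of consecutive values of \<open>g\<close> is a multiple of the summand. Below,
  with \<open>c = sin x\<close> or \<open>c = sinh y\<close>, the difference equation is an instance of the addition theorems,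
  expanded around \<open>t = (n + 1) x\<close>.
\<close>

lemma sum_eq_primitive_quotient:
  fixes f g :: "nat \<Rightarrow> 'a :: field"
  assumes "c \<noteq> 0" and "g 0 = 0" and "\<And>n. g n + c * f (Suc n) = g (Suc n)"
  shows "(\<Sum>k=1..n. f k) = g n / c"
proof (induction n)
  case (Suc n)
  then show ?case
    using assms(1) by (simp add: field_simps flip: assms(3))
qed (simp add: assms(2))

lemma sum_cos_double:
  fixes x :: real
  assumes "sin x \<noteq> 0"
  shows "(\<Sum>k=1..n. cos (2 * (real k * x))) = sin (real n * x) * cos ((real n + 1) * x) / sin x"
proof (rule sum_eq_primitive_quotient[OF assms])
  fix n
  define t where "t = (real n + 1) * x"
  have t: "real n * x = t - x" "real (Suc n) * x = t" "(real (Suc n) + 1) * x = t + x"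
    by (auto simp: t_def algebra_simps)
  show "sin (real n * x) * cos ((real n + 1) * x) + sin x * cos (2 * (real (Suc n) * x))
      = sin (real (Suc n) * x) * cos ((real (Suc n) + 1) * x)"
    unfolding t t_def[symmetric] sin_diff cos_add cos_double by algebra
qed simp

lemma sum_sin_double:
  fixes x :: real
  assumes "sin x \<noteq> 0"
  shows "(\<Sum>k=1..n. sin (2 * (real k * x))) = sin (real n * x) * sin ((real n + 1) * x) / sin x"
proof (rule sum_eq_primitive_quotient[OF assms])
  fix n
  define t where "t = (real n + 1) * x"
  have t: "real n * x = t - x" "real (Suc n) * x = t" "(real (Suc n) + 1) * x = t + x"
    by (auto simp: t_def algebra_simps)
  show "sin (real n * x) * sin ((real n + 1) * x) + sin x * sin (2 * (real (Suc n) * x))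
      = sin (real (Suc n) * x) * sin ((real (Suc n) + 1) * x)"
    unfolding t t_def[symmetric] sin_diff sin_add sin_double by algebra
qed simp

lemma sum_cosh_double:
  "(\<Sum>k=1..n. cosh (2 * (real k * y))) = sinh_quot n y * cosh ((real n + 1) * y)"
proof (cases "y = 0")
  case False
  then have "sinh y \<noteq> 0"
    by simp
  then have "(\<Sum>k=1..n. cosh (2 * (real k * y)))
      = sinh (real n * y) * cosh ((real n + 1) * y) / sinh y"
  proof (rule sum_eq_primitive_quotient)
    fix n
    define t where "t = (real n + 1) * y"
    have t: "real n * y = t - y" "real (Suc n) * y = t" "(real (Suc n) + 1) * y = t + y"
      by (auto simp: t_def algebra_simps)
    show "sinh (real n * y) * cosh ((real n + 1) * y) + sinh y * cosh (2 * (real (Suc n) * y))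
        = sinh (real (Suc n) * y) * cosh ((real (Suc n) + 1) * y)"
      unfolding t t_def[symmetric] sinh_diff cosh_add cosh_double by algebra
  qed simp
  then show ?thesis using False by (simp add: sinh_quot_def)
qed (simp add: sinh_quot_def)

lemma sum_sinh_double:
  "(\<Sum>k=1..n. sinh (2 * (real k * y))) = sinh_quot n y * sinh ((real n + 1) * y)"
proof (cases "y = 0")
  case False
  then have "sinh y \<noteq> 0"
    by simp
  then have "(\<Sum>k=1..n. sinh (2 * (real k * y)))
      = sinh (real n * y) * sinh ((real n + 1) * y) / sinh y"
  proof (rule sum_eq_primitive_quotient)
    fix n
    define t where "t = (real n + 1) * y"
    have t: "real n * y = t - y" "real (Suc n) * y = t" "(real (Suc n) + 1) * y = t + y"
      by (auto simp: t_def algebra_simps)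
    show "sinh (real n * y) * sinh ((real n + 1) * y) + sinh y * sinh (2 * (real (Suc n) * y))
        = sinh (real (Suc n) * y) * sinh ((real (Suc n) + 1) * y)"
      unfolding t t_def[symmetric] sinh_diff sinh_add sinh_double by algebra
  qed simp
  then show ?thesis using False by (simp add: sinh_quot_def)
qed (simp add: sinh_quot_def)

section \<open>Squared moduli of combinations of sine and cosine\<close>

lemma Re_sin_complex: "Re (sin z) = sin (Re z) * cosh (Im z)"
  and Im_sin_complex: "Im (sin z) = cos (Re z) * sinh (Im z)"
  and Re_cos_complex: "Re (cos z) = cos (Re z) * cosh (Im z)"
  and Im_cos_complex: "Im (cos z) = - (sin (Re z) * sinh (Im z))"
  by (auto simp: Re_sin Im_sin Re_cos Im_cos cosh_def sinh_def field_simps)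

lemma cmod_sin_squared_cosh: "(cmod (sin z))\<^sup>2 = (cosh (2 * Im z) - cos (2 * Re z)) / 2"
proof -
  have "(cmod (sin z))\<^sup>2 = (sin (Re z))\<^sup>2 * (cosh (Im z))\<^sup>2 + (cos (Re z))\<^sup>2 * (sinh (Im z))\<^sup>2"
    unfolding cmod_power2 Re_sin_complex Im_sin_complex power_mult_distrib ..
  then show ?thesis
    unfolding cosh_double cos_double cosh_square_eq cos_squared_eq by algebra
qed

lemma cmod_cos_squared_cosh: "(cmod (cos z))\<^sup>2 = (cosh (2 * Im z) + cos (2 * Re z)) / 2"
proof -
  have "(cmod (cos z))\<^sup>2 = (cos (Re z))\<^sup>2 * (cosh (Im z))\<^sup>2 + (sin (Re z))\<^sup>2 * (sinh (Im z))\<^sup>2"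
    unfolding cmod_power2 Re_cos_complex Im_cos_complex power2_minus power_mult_distrib ..
  then show ?thesis
    unfolding cosh_double cos_double cosh_square_eq cos_squared_eq by algebra
qed

lemma sin_times_cnj_cos:
  "sin z * cnj (cos z) = Complex (sin (2 * Re z) / 2) (sinh (2 * Im z) / 2)"
proof (rule complex_eqI)
  have "Re (sin z * cnj (cos z)) = sin (Re z) * cos (Re z) * ((cosh (Im z))\<^sup>2 - (sinh (Im z))\<^sup>2)"
    unfolding times_complex.simps cnj.simps Re_sin_complex Im_sin_complex Re_cos_complex Im_cos_complex
    by algebra
  then show "Re (sin z * cnj (cos z)) = Re (Complex (sin (2 * Re z) / 2) (sinh (2 * Im z) / 2))"
    by (simp add: sin_double cosh_square_eq)
  have "Im (sin z * cnj (cos z)) = sinh (Im z) * cosh (Im z) * ((cos (Re z))\<^sup>2 + (sin (Re z))\<^sup>2)"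
    unfolding times_complex.simps cnj.simps Re_sin_complex Im_sin_complex Re_cos_complex Im_cos_complex
    by algebra
  then show "Im (sin z * cnj (cos z)) = Im (Complex (sin (2 * Re z) / 2) (sinh (2 * Im z) / 2))"
    by (simp only: sinh_double sin_cos_squared_add2 complex.sel)
qed

lemma cmod_squared_diff:
  "(cmod (a - b))\<^sup>2 = (cmod a)\<^sup>2 + (cmod b)\<^sup>2 - 2 * Re (a * cnj b)"
  unfolding cmod_power2 minus_complex.simps times_complex.simps cnj.simps by algebra

text \<open>
  Expanding the square leaves only \<open>\<bar>sin z\<bar>\<^sup>2\<close>, \<open>\<bar>cos z\<bar>\<^sup>2\<close> and \<open>sin z * cnj (cos z)\<close>, each of which
  is a linear combination of functions of \<open>2 * Re z\<close> and of \<open>2 * Im z\<close> with real and imaginary part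
  separated. This is what makes the sum over multiples of a complex number computable.
\<close>

lemma cmod_sin_cos_combination_squared:
  "(cmod (\<mu> * sin z - \<nu> * cos z))\<^sup>2 =
     ((cmod \<nu>)\<^sup>2 - (cmod \<mu>)\<^sup>2) / 2 * cos (2 * Re z) + ((cmod \<nu>)\<^sup>2 + (cmod \<mu>)\<^sup>2) / 2 * cosh (2 * Im z)
     - Re (\<mu> * cnj \<nu>) * sin (2 * Re z) + Im (\<mu> * cnj \<nu>) * sinh (2 * Im z)"
proof -
  have "\<mu> * sin z * cnj (\<nu> * cos z) = (\<mu> * cnj \<nu>) * (sin z * cnj (cos z))"
    by simp
  also have "\<dots> = (\<mu> * cnj \<nu>) * Complex (sin (2 * Re z) / 2) (sinh (2 * Im z) / 2)"
    unfolding sin_times_cnj_cos ..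
  finally have "Re (\<mu> * sin z * cnj (\<nu> * cos z))
      = Re (\<mu> * cnj \<nu>) * (sin (2 * Re z) / 2) - Im (\<mu> * cnj \<nu>) * (sinh (2 * Im z) / 2)"
    by (simp only: times_complex.simps(1) complex.sel)
  then show ?thesis
    unfolding cmod_squared_diff norm_mult power_mult_distrib cmod_sin_squared_cosh cmod_cos_squared_cosh
    by algebra
qed

lemma sum_cmod_sin_cos_combination_squared:
  assumes "sin (Re s) \<noteq> 0"
  shows "(\<Sum>k=1..n. (cmod (\<mu> * sin (of_nat k * s) - \<nu> * cos (of_nat k * s)))\<^sup>2) =
           ((cmod \<nu>)\<^sup>2 - (cmod \<mu>)\<^sup>2) / 2
             * (sin (real n * Re s) * cos ((real n + 1) * Re s) / sin (Re s))
         + ((cmod \<nu>)\<^sup>2 + (cmod \<mu>)\<^sup>2) / 2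
             * (sinh_quot n (Im s) * cosh ((real n + 1) * Im s))
         - Re (\<mu> * cnj \<nu>) * (sin (real n * Re s) * sin ((real n + 1) * Re s) / sin (Re s))
         + Im (\<mu> * cnj \<nu>) * (sinh_quot n (Im s) * sinh ((real n + 1) * Im s))"
  unfolding cmod_sin_cos_combination_squared sum.distrib sum_subtractf sum_distrib_left[symmetric]
    sum_cos_double[OF assms, symmetric] sum_sin_double[OF assms, symmetric]
    sum_cosh_double[symmetric] sum_sinh_double[symmetric]
  by simp

section \<open>The norm of the eigenvectors\<close>

theorem theorem7:
  fixes \<gamma> :: complex and n j :: nat
  assumes "0 < cmod \<gamma>" and "cmod \<gamma> < 1"
    and "real n \<ge> N_const \<gamma>"
    and "j \<in> {1..n}"
  shows "let s = s_point \<gamma> n j;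
             \<mu> = 1 + \<i> * \<gamma> * cos s;
             \<nu> = \<i> * \<gamma> * sin s;
             \<xi> = (\<i> - \<gamma> * cos s) * cnj (\<gamma> * sin s)
         in (v_norm \<gamma> n j)\<^sup>2 =
              ((cmod \<nu>)\<^sup>2 - (cmod \<mu>)\<^sup>2) / 2
                * (sin (real n * Re s) * cos ((real n + 1) * Re s) / sin (Re s))
            + ((cmod \<nu>)\<^sup>2 + (cmod \<mu>)\<^sup>2) / 2
                * (sinh_quot n (Im s) * cosh ((real n + 1) * Im s))
            + Re \<xi> * (sin (real n * Re s) * sin ((real n + 1) * Re s) / sin (Re s))
            - Im \<xi> * (sinh_quot n (Im s) * sinh ((real n + 1) * Im s))"
proof -
  define s where "s = s_point \<gamma> n j"
  define \<mu> where "\<mu> = 1 + \<i> * \<gamma> * cos s"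
  define \<nu> where "\<nu> = \<i> * \<gamma> * sin s"
  define \<xi> where "\<xi> = (\<i> - \<gamma> * cos s) * cnj (\<gamma> * sin s)"
  have sin_nz: "sin (Re s) \<noteq> 0"
    using Re_s_point_bounds[OF assms] sin_gt_zero[of "Re s"] unfolding s_def by simp
  have \<xi>: "\<mu> * cnj \<nu> = - \<xi>"
    by (simp add: \<mu>_def \<nu>_def \<xi>_def algebra_simps)
  have comp: "cmod (v_comp \<gamma> n j k) = cmod (\<mu> * sin (of_nat k * s) - \<nu> * cos (of_nat k * s))" for k
  proof -
    have "sin ((of_nat k - 1) * s) = sin (of_nat k * s) * cos s - cos (of_nat k * s) * sin s"
      by (simp add: left_diff_distrib sin_diff)
    then have "sin (of_nat k * s) + \<i> * \<gamma> * sin ((of_nat k - 1) * s)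
        = \<mu> * sin (of_nat k * s) - \<nu> * cos (of_nat k * s)"
      unfolding \<mu>_def \<nu>_def by algebra
    then show ?thesis
      by (simp add: v_comp_def s_def[symmetric] norm_mult norm_power)
  qed
  have "(v_norm \<gamma> n j)\<^sup>2 = (\<Sum>k=1..n. (cmod (\<mu> * sin (of_nat k * s) - \<nu> * cos (of_nat k * s)))\<^sup>2)"
    unfolding v_norm_def L2_set_def comp by (intro real_sqrt_pow2 sum_nonneg) simp
  then show ?thesis
    unfolding sum_cmod_sin_cos_combination_squared[OF sin_nz] \<xi>
    by (simp only: Let_def s_def[symmetric] \<mu>_def[symmetric] \<nu>_def[symmetric] \<xi>_def[symmetric]
        uminus_complex.simps mult_minus_left diff_minus_eq_add add_uminus_conv_diff)
qed

end
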